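(* Let $\mathcal{H}$ be a topological vector space, let $Y:\mathcal{H}\to\mathcal{H}$ be a continuous map (not assumed linear), and let $\mathbb{X}$ be a collection of continuous linear operators on $\mathcal{H}$. Then $Y$ is in the strong operator topology closure of the unital algebra generated by the elements of $\mathbb{X}$ if and only if for every $n\in\mathbb{N}$, every closed linear subspace $S\subseteq\mathcal{H}^n$ that is invariant for $X^{\oplus n}$ for all $X\in\mathbb{X}$ is also invariant for $Y^{\oplus n}$.
   Context: For a map $Z:\mathcal{H}\to\mathcal{H}$, $Z^{\oplus n}:\mathcal{H}^n\to\mathcal{H}^n$ is the coordinatewise map $(v_1,\dots,v_n)\mapsto(Zv_1,\dots,Zv_n)$. A set $S\subseteq\mathcal{H}^n$ is invariant for $Z^{\oplus n}$ if $Z^{\oplus n}S\subseteq S$. The strong operator topology is the topology of pointwise convergence on the set of continuous maps $\mathcal{H}\to\mathcal{H}$, and the closure is taken in that set. *)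

theory Defs
  imports "HOL-Analysis.Analysis"
begin

text \<open>Up to isomorphism of topological fields, the instances of \<^class>\<open>real_normed_field\<close> are
  exactly the real and the complex numbers.  Joint continuity of addition and continuity of
  negation are part of \<^class>\<open>topological_ab_group_add\<close>.  No separation axiom is imposed.\<close>

locale topological_vector_space = vector_space scl
  for scl :: "'k::real_normed_field \<Rightarrow> 'h::topological_ab_group_add \<Rightarrow> 'h" +
  assumes continuous_scale: "continuous_on UNIV (\<lambda>(c, v). scl c v)"

definition continuous_linear_operators ::
    "('k::real_normed_field \<Rightarrow> 'h::topological_ab_group_add \<Rightarrow> 'h) \<Rightarrow> ('h \<Rightarrow> 'h) set"
  where "continuous_linear_operators scl =
    {T. Vector_Spaces.linear scl scl T \<and> continuous_on UNIV T}"

definition unital_operator_algebra ::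
    "('k::real_normed_field \<Rightarrow> 'h::topological_ab_group_add \<Rightarrow> 'h) \<Rightarrow> ('h \<Rightarrow> 'h) set \<Rightarrow> bool"
  where "unital_operator_algebra scl A \<longleftrightarrow>
    A \<subseteq> continuous_linear_operators scl \<and>
    id \<in> A \<and>
    (\<forall>S\<in>A. \<forall>T\<in>A. (\<lambda>v. S v + T v) \<in> A) \<and>
    (\<forall>c. \<forall>T\<in>A. (\<lambda>v. scl c (T v)) \<in> A) \<and>
    (\<forall>S\<in>A. \<forall>T\<in>A. S \<circ> T \<in> A)"

definition generated_unital_algebra ::
    "('k::real_normed_field \<Rightarrow> 'h::topological_ab_group_add \<Rightarrow> 'h) \<Rightarrow> ('h \<Rightarrow> 'h) set
      \<Rightarrow> ('h \<Rightarrow> 'h) set"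
  where "generated_unital_algebra scl \<X> = unital_operator_algebra scl hull \<X>"

text \<open>The strong operator topology of the library lives on bounded linear functions between normed
  spaces; here it is the topology of pointwise convergence on all continuous maps.\<close>

definition pointwise_strong_topology :: "('h::topological_space \<Rightarrow> 'h) topology"
  where "pointwise_strong_topology =
    subtopology (product_topology (\<lambda>_. euclidean) UNIV) {T. continuous_on UNIV T}"

text \<open>The space \<open>H^n\<close> is represented by the extensional functions \<open>{..<n} \<rightarrow>\<^sub>E UNIV\<close>, so that
  \<open>n\<close> can be quantified inside a formula; operations on it are restricted to \<open>{..<n}\<close> accordingly.\<close>

definition power_topology :: "nat \<Rightarrow> (nat \<Rightarrow> 'h::topological_space) topology"
  where "power_topology n = product_topology (\<lambda>_. euclidean) {..<n}"

definition power_subspace ::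
    "('k::real_normed_field \<Rightarrow> 'h::topological_ab_group_add \<Rightarrow> 'h) \<Rightarrow> nat
      \<Rightarrow> (nat \<Rightarrow> 'h) set \<Rightarrow> bool"
  where "power_subspace scl n S \<longleftrightarrow>
    S \<subseteq> {..<n} \<rightarrow>\<^sub>E UNIV \<and>
    (\<lambda>i\<in>{..<n}. 0) \<in> S \<and>
    (\<forall>u\<in>S. \<forall>v\<in>S. (\<lambda>i\<in>{..<n}. u i + v i) \<in> S) \<and>
    (\<forall>c. \<forall>v\<in>S. (\<lambda>i\<in>{..<n}. scl c (v i)) \<in> S)"

definition direct_sum_power :: "nat \<Rightarrow> ('h \<Rightarrow> 'h) \<Rightarrow> (nat \<Rightarrow> 'h) \<Rightarrow> (nat \<Rightarrow> 'h)"
  where "direct_sum_power n Z v = (\<lambda>i\<in>{..<n}. Z (v i))"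

definition invariant_for :: "(nat \<Rightarrow> 'h) set \<Rightarrow> ((nat \<Rightarrow> 'h) \<Rightarrow> (nat \<Rightarrow> 'h)) \<Rightarrow> bool"
  where "invariant_for S F \<longleftrightarrow> F ` S \<subseteq> S"

text \<open>By the next lemma the hull above is an intersection over a nonempty family whenever the
  generators are continuous linear operators.\<close>

lemma (in topological_vector_space) unital_operator_algebra_continuous_linear_operators:
  "unital_operator_algebra scl (continuous_linear_operators scl)"
proof -
  have lin: "Vector_Spaces.linear scl scl T \<longleftrightarrow>
      (\<forall>u v. T (u + v) = T u + T v) \<and> (\<forall>c v. T (scl c v) = scl c (T v))" for T
    by (auto simp: Vector_Spaces.linear_iff vector_space_axioms)
  have cont: "continuous_on UNIV (\<lambda>v. scl c (T v))" if "continuous_on UNIV T" for c T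
    using continuous_on_compose2[OF continuous_scale continuous_on_Pair[OF continuous_on_const that]]
    by simp
  show ?thesis
    unfolding unital_operator_algebra_def continuous_linear_operators_def
    by (auto simp: lin cont scale_right_distrib mult.commute ac_simps id_def comp_def
        intro: continuous_on_add continuous_on_compose2)
qed

end

theory Submission
  imports Defs
begin

text \<open>
  Pointwise approximation of \<open>Y\<close> only ever sees finitely many vectors at a time.  Listing these
  vectors as a tuple \<open>v\<close> of length \<open>n\<close> turns the strong operator closure of a set \<open>\<A>\<close> of maps
  into a statement about the orbits of tuples: \<open>Y\<close> lies in the closure of \<open>\<A>\<close> iff
  \<open>Y\<^sup>\<oplus>\<^sup>n v\<close> lies in the closure of the orbit \<open>{T\<^sup>\<oplus>\<^sup>n v | T \<in> \<A>}\<close> for all \<open>n\<close> and \<open>v\<close>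
  (lemma \<open>pointwise_closure_iff_orbit_closures\<close>).

  When \<open>\<A>\<close> is the unital algebra generated by \<open>\<X>\<close>, the closure of the orbit of \<open>v\<close> is the
  smallest closed \<open>\<X>\<close>-invariant subspace that contains \<open>v\<close>.  It is such a subspace because
  \<open>\<A>\<close> is an algebra and the operations on \<open>H\<^sup>n\<close> are continuous, and it contains \<open>v\<close> because
  \<open>id \<in> \<A>\<close>.  It is the smallest one because the continuous operators leaving a given subspace invariant form
  a unital algebra, so that a subspace invariant for \<open>\<X>\<close> is invariant for \<open>\<A>\<close>.
  Hence an \<open>Y\<close> that preserves all closed invariant subspaces maps \<open>v\<close> into its orbit closure, and
  conversely if \<open>Y\<^sup>\<oplus>\<^sup>n v\<close> is always in the orbit closure, then it is in every closed invariant
  subspace containing \<open>v\<close>.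
\<close>

section \<open>Orbits of tuples and pointwise approximation\<close>

definition tuple_orbit :: "nat \<Rightarrow> ('h \<Rightarrow> 'h) set \<Rightarrow> (nat \<Rightarrow> 'h) \<Rightarrow> (nat \<Rightarrow> 'h) set"
  where "tuple_orbit n \<A> v = (\<lambda>T. direct_sum_power n T v) ` \<A>"

lemma topspace_power_topology [simp]: "topspace (power_topology n) = {..<n} \<rightarrow>\<^sub>E UNIV"
  by (simp add: power_topology_def)

lemma direct_sum_power_PiE: "direct_sum_power n T v \<in> {..<n} \<rightarrow>\<^sub>E UNIV"
  by (simp add: direct_sum_power_def)

lemma tuple_orbit_subset: "tuple_orbit n \<A> v \<subseteq> {..<n} \<rightarrow>\<^sub>E UNIV"
  unfolding tuple_orbit_def by (rule image_subsetI) (rule direct_sum_power_PiE)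

lemma continuous_map_power_topology_component:
  "i < n \<Longrightarrow> continuous_map (power_topology n) euclidean (\<lambda>v. v i)"
  unfolding power_topology_def by (rule continuous_map_product_projection) simp

lemma continuous_map_into_power_topology:
  assumes "\<And>i. i < n \<Longrightarrow> continuous_map X euclidean (\<lambda>x. f x i)"
  shows "continuous_map X (power_topology n) (\<lambda>x. \<lambda>i\<in>{..<n}. f x i)"
  unfolding power_topology_def using assms
  by (auto simp: continuous_map_componentwise restrict_extensional)

lemma continuous_map_direct_sum_power:
  assumes "continuous_on UNIV T"
  shows "continuous_map (power_topology n) (power_topology n) (direct_sum_power n T)"
proof -
  have "continuous_map (power_topology n) euclidean (\<lambda>v. T (v i))" if "i < n" for i
    using continuous_map_compose[OF continuous_map_power_topology_component[OF that], of euclidean T]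
      assms by (simp add: o_def)
  from continuous_map_into_power_topology[OF this] show ?thesis
    by (simp add: direct_sum_power_def[abs_def])
qed

lemma continuous_map_tuple_evaluation:
  "continuous_map pointwise_strong_topology (power_topology n) (\<lambda>T. direct_sum_power n T v)"
  unfolding direct_sum_power_def
proof (rule continuous_map_into_power_topology)
  fix i
  show "continuous_map pointwise_strong_topology euclidean (\<lambda>T. T (v i))"
    unfolding pointwise_strong_topology_def
    by (intro continuous_map_from_subtopology continuous_map_product_projection) simp
qed

text \<open>A basic neighbourhood in the topology of pointwise convergence constrains only finitely many
  values; enumerating the points at which it does gives the tuple \<open>v\<close>.\<close>

lemma pointwise_closure_iff_orbit_closures:
  assumes Y: "continuous_on UNIV Y" and \<A>: "\<And>T. T \<in> \<A> \<Longrightarrow> continuous_on UNIV T"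
  shows "Y \<in> pointwise_strong_topology closure_of \<A> \<longleftrightarrow>
    (\<forall>n. \<forall>v\<in>{..<n} \<rightarrow>\<^sub>E UNIV.
      direct_sum_power n Y v \<in> power_topology n closure_of tuple_orbit n \<A> v)"
    (is "?closure \<longleftrightarrow> ?orbits")
proof
  assume ?closure
  then show ?orbits
    using continuous_map_image_closure_subset[OF continuous_map_tuple_evaluation]
    unfolding tuple_orbit_def by blast
next
  assume orbits: ?orbits
  have "Y \<in> product_topology (\<lambda>_. euclidean) UNIV closure_of \<A>"
    unfolding in_closure_of
  proof (intro conjI allI impI)
    fix W assume "Y \<in> W \<and> openin (product_topology (\<lambda>_. euclidean) UNIV) W"
    then obtain U where fin: "finite {x. U x \<noteq> UNIV}" and op: "\<And>x. open (U x)"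
      and YU: "\<And>x. Y x \<in> U x" and UW: "(\<Pi>\<^sub>E x\<in>UNIV. U x) \<subseteq> W"
      unfolding openin_product_topology_alt by (fastforce simp: PiE_iff)
    obtain h and n :: nat where h: "bij_betw h {0..<n} {x. U x \<noteq> UNIV}"
      using ex_bij_betw_nat_finite[OF fin] by blast
    define v where "v = restrict h {..<n}"
    have v: "v \<in> {..<n} \<rightarrow>\<^sub>E UNIV" by (simp add: v_def)
    have "openin (power_topology n) (\<Pi>\<^sub>E i\<in>{..<n}. U (v i))"
      unfolding power_topology_def by (simp add: openin_PiE op)
    moreover have "direct_sum_power n Y v \<in> (\<Pi>\<^sub>E i\<in>{..<n}. U (v i))"
      by (auto simp: direct_sum_power_def YU)
    moreover have "direct_sum_power n Y v \<in> power_topology n closure_of tuple_orbit n \<A> v"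
      using orbits v by blast
    ultimately obtain T where T: "T \<in> \<A>"
      and TU: "direct_sum_power n T v \<in> (\<Pi>\<^sub>E i\<in>{..<n}. U (v i))"
      unfolding in_closure_of tuple_orbit_def by blast
    have "T x \<in> U x" for x
    proof (cases "U x = UNIV")
      case False
      then obtain i where "i < n" "x = h i"
        using h by (force simp: bij_betw_def)
      with TU show ?thesis by (auto simp: direct_sum_power_def v_def PiE_iff)
    qed simp
    with UW T show "\<exists>T. T \<in> \<A> \<and> T \<in> W" by auto
  qed simp
  moreover have "{T. continuous_on UNIV T} \<inter> \<A> = \<A>" using \<A> by blast
  ultimately show ?closure
    using Y by (simp add: pointwise_strong_topology_def closure_of_subtopology)
qed

section \<open>Closed subspaces of a power\<close>

text \<open>Each operation of \<open>H\<^sup>n\<close> is continuous, so it maps the closure of a set stable under it into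
  that closure.\<close>

lemma power_subspace_closure_of:
  fixes scl :: "'k::real_normed_field \<Rightarrow> 'h::topological_ab_group_add \<Rightarrow> 'h"
  assumes "topological_vector_space scl" and S: "power_subspace scl n S"
  shows "power_subspace scl n (power_topology n closure_of S)"
proof -
  interpret topological_vector_space scl by fact
  let ?P = "power_topology n :: (nat \<Rightarrow> 'h) topology"
  let ?add = "\<lambda>(u, v). \<lambda>i\<in>{..<n}. (u i + v i :: 'h)"
  have SP: "S \<subseteq> ?P closure_of S"
    using S by (intro closure_of_subset) (simp add: power_subspace_def)
  have "continuous_map (prod_topology ?P ?P) euclidean (\<lambda>p. fst p i + snd p i)" if "i < n" for i
  proof -
    have comp: "continuous_map ?P euclidean (\<lambda>v. v i)"
      using that by (rule continuous_map_power_topology_component)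
    have "continuous_map (prod_topology ?P ?P) euclidean (\<lambda>p. (fst p i, snd p i))"
      using continuous_map_compose[OF continuous_map_fst[of ?P ?P] comp]
        continuous_map_compose[OF continuous_map_snd[of ?P ?P] comp]
      unfolding prod_topology_euclidean[symmetric] continuous_map_pairwise
      by (simp add: o_def)
    moreover have "continuous_map euclidean euclidean (\<lambda>q::'h \<times> 'h. fst q + snd q)"
      by (simp add: continuous_on_add continuous_on_fst continuous_on_snd)
    ultimately have "continuous_map (prod_topology ?P ?P) euclidean
        ((\<lambda>q. fst q + snd q) \<circ> (\<lambda>p. (fst p i, snd p i)))"
      by (rule continuous_map_compose)
    then show ?thesis by (simp add: o_def)
  qed
  from continuous_map_into_power_topology[OF this]
  have "continuous_map (prod_topology ?P ?P) ?P ?add"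
    by (simp add: case_prod_beta')
  from continuous_map_image_closure_subset[OF this, of "S \<times> S"]
  have "?add ` ((?P closure_of S) \<times> (?P closure_of S)) \<subseteq> ?P closure_of (?add ` (S \<times> S))"
    by (simp add: closure_of_Times)
  also have "\<dots> \<subseteq> ?P closure_of S"
    using S by (intro closure_of_mono) (auto simp: power_subspace_def)
  finally have add: "(\<lambda>i\<in>{..<n}. u i + v i) \<in> ?P closure_of S"
    if "u \<in> ?P closure_of S" "v \<in> ?P closure_of S" for u v
    using that by force
  have scale: "(\<lambda>i\<in>{..<n}. scl c (v i)) \<in> ?P closure_of S" if "v \<in> ?P closure_of S" for c v
  proof -
    have "continuous_on UNIV (scl c)"
      using continuous_on_compose2[OF continuous_scale
          continuous_on_Pair[OF continuous_on_const continuous_on_id]]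
      by simp
    from continuous_map_image_closure_subset[OF continuous_map_direct_sum_power[OF this]]
    have "direct_sum_power n (scl c) v \<in> ?P closure_of (direct_sum_power n (scl c) ` S)"
      using that by blast
    also have "\<dots> \<subseteq> ?P closure_of S"
      using S by (intro closure_of_mono) (auto simp: power_subspace_def direct_sum_power_def)
    finally show ?thesis by (simp add: direct_sum_power_def)
  qed
  have "?P closure_of S \<subseteq> {..<n} \<rightarrow>\<^sub>E UNIV"
    using closure_of_subset_topspace[of ?P S] by simp
  then show ?thesis
    using S SP add scale by (auto simp: power_subspace_def)
qed

lemma invariant_for_closure_of:
  assumes "continuous_on UNIV T" "invariant_for S (direct_sum_power n T)"
  shows "invariant_for (power_topology n closure_of S) (direct_sum_power n T)"
  using continuous_map_image_closure_subset[OF continuous_map_direct_sum_power[OF assms(1)], of n S]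
    closure_of_mono assms(2) unfolding invariant_for_def by blast

section \<open>The generated algebra and invariant subspaces\<close>

lemma unital_operator_algebra_generated:
  assumes "topological_vector_space scl" "\<X> \<subseteq> continuous_linear_operators scl"
  shows "unital_operator_algebra scl (generated_unital_algebra scl \<X>)"
proof -
  let ?C = "continuous_linear_operators scl"
  let ?F = "{A. unital_operator_algebra scl A \<and> \<X> \<subseteq> A}"
  have C: "unital_operator_algebra scl ?C"
    by (rule topological_vector_space.unital_operator_algebra_continuous_linear_operators) fact
  with assms(2) have "\<Inter>?F \<subseteq> ?C" by blast
  then have "unital_operator_algebra scl (\<Inter>?F)"
    unfolding unital_operator_algebra_def[of scl "\<Inter>?F"]
    by (auto simp: unital_operator_algebra_def)
  then show ?thesis by (simp add: generated_unital_algebra_def hull_def)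
qed

text \<open>The continuous operators that leave a fixed subspace invariant form a unital algebra, so invariance
  passes from the generators to everything they generate.\<close>

lemma invariant_for_generated_unital_algebra:
  assumes tvs: "topological_vector_space scl" and \<X>: "\<X> \<subseteq> continuous_linear_operators scl"
    and S: "power_subspace scl n S"
    and inv: "\<And>X. X \<in> \<X> \<Longrightarrow> invariant_for S (direct_sum_power n X)"
    and T: "T \<in> generated_unital_algebra scl \<X>"
  shows "invariant_for S (direct_sum_power n T)"
proof -
  let ?C = "continuous_linear_operators scl"
  let ?B = "{T \<in> ?C. invariant_for S (direct_sum_power n T)}"
  have C: "unital_operator_algebra scl ?C"
    by (rule topological_vector_space.unital_operator_algebra_continuous_linear_operators) fact
  have id: "direct_sum_power n id v = v" if "v \<in> S" for v
    using that S by (auto simp: direct_sum_power_def power_subspace_def PiE_def extensional_restrict)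
  have comp: "direct_sum_power n (Q \<circ> R) v = direct_sum_power n Q (direct_sum_power n R v)"
    for Q R :: "'b \<Rightarrow> 'b" and v
    by (auto simp: direct_sum_power_def)
  have add: "direct_sum_power n (\<lambda>x. Q x + R x) v =
      (\<lambda>i\<in>{..<n}. direct_sum_power n Q v i + direct_sum_power n R v i)" for Q R :: "'b \<Rightarrow> 'b" and v
    by (auto simp: direct_sum_power_def)
  have scale: "direct_sum_power n (\<lambda>x. scl c (Q x)) v =
      (\<lambda>i\<in>{..<n}. scl c (direct_sum_power n Q v i))" for c Q v
    by (auto simp: direct_sum_power_def)
  have "unital_operator_algebra scl ?B"
    using C S unfolding unital_operator_algebra_def power_subspace_def
    by (auto simp: invariant_for_def image_subset_iff id comp add scale)
  moreover have "\<X> \<subseteq> ?B" using \<X> inv by blast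
  ultimately have "generated_unital_algebra scl \<X> \<subseteq> ?B"
    unfolding generated_unital_algebra_def by (intro hull_minimal)
  with T show ?thesis by blast
qed

lemma power_subspace_tuple_orbit:
  assumes tvs: "topological_vector_space scl" and \<A>: "unital_operator_algebra scl \<A>"
  shows "power_subspace scl n (tuple_orbit n \<A> v)"
proof -
  interpret topological_vector_space scl by fact
  have zero: "(\<lambda>i\<in>{..<n}. 0) \<in> tuple_orbit n \<A> v"
  proof -
    \<comment> \<open>the zero operator, as a multiple of the identity\<close>
    have "(\<lambda>x. scl 0 (id x)) \<in> \<A>"
      using \<A> unfolding unital_operator_algebra_def by blast
    from imageI[OF this, of "\<lambda>T. direct_sum_power n T v"]
    show ?thesis by (simp add: tuple_orbit_def direct_sum_power_def)
  qed
  have add: "(\<lambda>i\<in>{..<n}. direct_sum_power n Q v i + direct_sum_power n R v i) \<in> tuple_orbit n \<A> v"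
    if "Q \<in> \<A>" "R \<in> \<A>" for Q R
  proof -
    have "(\<lambda>x. Q x + R x) \<in> \<A>" using \<A> that by (simp add: unital_operator_algebra_def)
    from imageI[OF this, of "\<lambda>T. direct_sum_power n T v"]
    show ?thesis by (simp add: tuple_orbit_def direct_sum_power_def cong: restrict_cong)
  qed
  have scale: "(\<lambda>i\<in>{..<n}. scl c (direct_sum_power n Q v i)) \<in> tuple_orbit n \<A> v"
    if "Q \<in> \<A>" for c Q
  proof -
    have "(\<lambda>x. scl c (Q x)) \<in> \<A>" using \<A> that by (simp add: unital_operator_algebra_def)
    from imageI[OF this, of "\<lambda>T. direct_sum_power n T v"]
    show ?thesis by (simp add: tuple_orbit_def direct_sum_power_def cong: restrict_cong)
  qed
  show ?thesis
    unfolding power_subspace_def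
  proof (intro conjI ballI allI)
    show "(\<lambda>i\<in>{..<n}. a i + b i) \<in> tuple_orbit n \<A> v"
      if "a \<in> tuple_orbit n \<A> v" "b \<in> tuple_orbit n \<A> v" for a b
      using that add unfolding tuple_orbit_def by blast
    show "(\<lambda>i\<in>{..<n}. scl c (a i)) \<in> tuple_orbit n \<A> v"
      if "a \<in> tuple_orbit n \<A> v" for a c
      using that scale unfolding tuple_orbit_def by blast
  qed (fact tuple_orbit_subset zero)+
qed

lemma invariant_for_tuple_orbit:
  assumes \<A>: "unital_operator_algebra scl \<A>" and X: "X \<in> \<A>"
  shows "invariant_for (tuple_orbit n \<A> v) (direct_sum_power n X)"
proof -
  have "direct_sum_power n X (direct_sum_power n T v) \<in> tuple_orbit n \<A> v" if "T \<in> \<A>" for T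
  proof -
    have "X \<circ> T \<in> \<A>" using \<A> X that by (simp add: unital_operator_algebra_def)
    from imageI[OF this, of "\<lambda>T. direct_sum_power n T v"]
    show ?thesis by (simp add: tuple_orbit_def direct_sum_power_def cong: restrict_cong)
  qed
  then show ?thesis by (auto simp: invariant_for_def tuple_orbit_def)
qed

lemma in_tuple_orbit:
  assumes "unital_operator_algebra scl \<A>" "v \<in> {..<n} \<rightarrow>\<^sub>E UNIV"
  shows "v \<in> tuple_orbit n \<A> v"
proof -
  have "id \<in> \<A>" using assms(1) by (simp add: unital_operator_algebra_def)
  from imageI[OF this, of "\<lambda>T. direct_sum_power n T v"] show ?thesis
    using assms(2) by (simp add: tuple_orbit_def direct_sum_power_def PiE_def extensional_restrict)
qed

theorem mainTheorem1:
  fixes scl :: "'k::real_normed_field \<Rightarrow> 'h::topological_ab_group_add \<Rightarrow> 'h"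
    and Y :: "'h \<Rightarrow> 'h"
    and \<X> :: "('h \<Rightarrow> 'h) set"
  assumes "topological_vector_space scl"
    and "continuous_on UNIV Y"
    and "\<X> \<subseteq> continuous_linear_operators scl"
  shows "Y \<in> pointwise_strong_topology closure_of (generated_unital_algebra scl \<X>) \<longleftrightarrow>
    (\<forall>n S. closedin (power_topology n) S \<and> power_subspace scl n S \<and>
        (\<forall>X\<in>\<X>. invariant_for S (direct_sum_power n X)) \<longrightarrow>
      invariant_for S (direct_sum_power n Y))"
proof -
  let ?\<A> = "generated_unital_algebra scl \<X>"
  have alg: "unital_operator_algebra scl ?\<A>"
    using assms(1,3) by (rule unital_operator_algebra_generated)
  then have cont: "continuous_on UNIV T" if "T \<in> ?\<A>" for T
    using that by (auto simp: unital_operator_algebra_def continuous_linear_operators_def)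
  have gen: "\<X> \<subseteq> ?\<A>"
    unfolding generated_unital_algebra_def by (rule hull_subset)
  note closure_iff = pointwise_closure_iff_orbit_closures[OF assms(2) cont]
  show ?thesis
  proof (intro iffI allI impI; (elim conjE)?)
    fix n S
    assume "Y \<in> pointwise_strong_topology closure_of ?\<A>"
      and closed: "closedin (power_topology n) S" and S: "power_subspace scl n S"
      and inv: "\<forall>X\<in>\<X>. invariant_for S (direct_sum_power n X)"
    then have orbit: "direct_sum_power n Y v \<in> power_topology n closure_of tuple_orbit n ?\<A> v"
      if "v \<in> S" for v
      using closure_iff that by (auto simp: power_subspace_def)
    have "tuple_orbit n ?\<A> v \<subseteq> S" if "v \<in> S" for v
      using invariant_for_generated_unital_algebra[OF assms(1,3) S] inv that
      by (auto simp: tuple_orbit_def invariant_for_def image_subset_iff)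
    then have "power_topology n closure_of tuple_orbit n ?\<A> v \<subseteq> S" if "v \<in> S" for v
      using closed that by (simp add: closure_of_minimal)
    with orbit show "invariant_for S (direct_sum_power n Y)"
      by (auto simp: invariant_for_def)
  next
    assume R: "\<forall>n S. closedin (power_topology n) S \<and> power_subspace scl n S \<and>
        (\<forall>X\<in>\<X>. invariant_for S (direct_sum_power n X)) \<longrightarrow>
      invariant_for S (direct_sum_power n Y)"
    have "direct_sum_power n Y v \<in> power_topology n closure_of tuple_orbit n ?\<A> v"
      if v: "v \<in> {..<n} \<rightarrow>\<^sub>E UNIV" for n v
    proof -
      let ?S = "power_topology n closure_of tuple_orbit n ?\<A> v"
      have "power_subspace scl n ?S"
        by (intro power_subspace_closure_of power_subspace_tuple_orbit assms(1) alg)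
      moreover have "invariant_for ?S (direct_sum_power n X)" if "X \<in> \<X>" for X
        using that gen cont alg by (blast intro: invariant_for_closure_of invariant_for_tuple_orbit)
      ultimately have "invariant_for ?S (direct_sum_power n Y)"
        using R by simp
      moreover have "v \<in> ?S"
        using closure_of_subset[of "tuple_orbit n ?\<A> v" "power_topology n"]
          tuple_orbit_subset[of n ?\<A> v] in_tuple_orbit[OF alg v] by auto
      ultimately show ?thesis by (auto simp: invariant_for_def)
    qed
    then show "Y \<in> pointwise_strong_topology closure_of ?\<A>"
      using closure_iff by blast
  qed
qed

end
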